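(* Let $\mathbf w=(w_0,\dots,w_n)$ be a vector of positive integers, $T=\{0,\dots,n\}$, and let $f_1,\dots,f_m\in\mathbb F_q[x_0,\dots,x_n]$ be weighted homogeneous polynomials with respect to the grading $\deg x_i=w_i$. Let $\widehat X=\{x\in\mathbb A^{n+1}:f_1(x)=\cdots=f_m(x)=0\}$ and let $A_X(q)=\#\bigl((\widehat X(\mathbb F_q)\setminus\{0\})/\mathbb F_q^\times\bigr)$ be the number of $\mathbb F_q^\times$-orbits for the weighted action. For nonempty $S\subseteq T$ let $N_X(S;q)=\#\{x\in\widehat X(\mathbb F_q):\operatorname{Supp}(x)=S\}$ and $k_S=\gcd\{w_i:i\in S\}$. Then $$A_X(q)=\sum_{\emptyset\ne S\subseteq T}\frac{N_X(S;q)}{q-1}\gcd(k_S,q-1).$$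
   Context: The weighted action is $\lambda\cdot(x_0,\dots,x_n)=(\lambda^{w_0}x_0,\dots,\lambda^{w_n}x_n)$ for $\lambda\in\mathbb F_q^\times$, and $\operatorname{Supp}(x)=\{i:x_i\ne0\}$. *)

theory Defs
  imports Complex_Main "HOL-Library.Cardinality" "HOL-Library.FuncSet"
    "HOL-Library.Poly_Mapping" "HOL-Algebra.Group_Action"
begin

text \<open>
  A finite field with q elements is a type of class \<open>{field, finite}\<close> with \<open>q = CARD('a)\<close>.
  An exponent vector is a finitely supported function \<open>nat \<Rightarrow>\<^sub>0 nat\<close>, and a polynomial
  in variables \<open>x\<^sub>0, x\<^sub>1, \<dots>\<close> is a finitely supported map from exponent vectors to coefficients
  (its ring structure is the convolution product of Poly_Mapping).
\<close>

type_synonym 'a mpoly = "(nat \<Rightarrow>\<^sub>0 nat) \<Rightarrow>\<^sub>0 'a"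

definition polys_in :: "nat \<Rightarrow> 'a::zero mpoly set" where
  "polys_in n = {f. \<forall>a \<in> Poly_Mapping.keys f. Poly_Mapping.keys a \<subseteq> {0..n}}"

definition mpoly_eval :: "'a::comm_semiring_1 mpoly \<Rightarrow> (nat \<Rightarrow> 'a) \<Rightarrow> 'a" where
  "mpoly_eval f x =
     (\<Sum>a \<in> Poly_Mapping.keys f. Poly_Mapping.lookup f a *
        (\<Prod>i \<in> Poly_Mapping.keys a. x i ^ Poly_Mapping.lookup a i))"

definition weighted_degree :: "(nat \<Rightarrow> nat) \<Rightarrow> (nat \<Rightarrow>\<^sub>0 nat) \<Rightarrow> nat" where
  "weighted_degree w a = (\<Sum>i \<in> Poly_Mapping.keys a. w i * Poly_Mapping.lookup a i)"

text \<open>The zero polynomial is weighted homogeneous (of every degree).\<close>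

definition weighted_homogeneous :: "(nat \<Rightarrow> nat) \<Rightarrow> 'a::zero mpoly \<Rightarrow> bool" where
  "weighted_homogeneous w f \<longleftrightarrow> (\<exists>d. \<forall>a \<in> Poly_Mapping.keys f. weighted_degree w a = d)"

text \<open>
  The rational points of affine (n+1)-space. Points are extensional functions on \<open>{0..n}\<close>, i.e.
  they take the value \<^term>\<open>undefined\<close> elsewhere, so that each tuple has exactly one representative.
\<close>

definition affine_space :: "nat \<Rightarrow> (nat \<Rightarrow> 'a) set" where
  "affine_space n = {0..n} \<rightarrow>\<^sub>E UNIV"

definition origin :: "nat \<Rightarrow> nat \<Rightarrow> 'a::zero" where
  "origin n = (\<lambda>i\<in>{0..n}. 0)"

definition zero_locus :: "nat \<Rightarrow> nat \<Rightarrow> (nat \<Rightarrow> 'a::comm_semiring_1 mpoly) \<Rightarrow> (nat \<Rightarrow> 'a) set" where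
  "zero_locus n m f = {x \<in> affine_space n. \<forall>j \<in> {1..m}. mpoly_eval (f j) x = 0}"

definition Supp :: "nat \<Rightarrow> (nat \<Rightarrow> 'a::zero) \<Rightarrow> nat set" where
  "Supp n x = {i \<in> {0..n}. x i \<noteq> 0}"

definition mult_group :: "'a::field monoid" where
  "mult_group = \<lparr>carrier = - {0}, mult = (*), one = 1\<rparr>"

definition weighted_act :: "nat \<Rightarrow> (nat \<Rightarrow> nat) \<Rightarrow> 'a::field \<Rightarrow> (nat \<Rightarrow> 'a) \<Rightarrow> nat \<Rightarrow> 'a" where
  "weighted_act n w c x = (\<lambda>i\<in>{0..n}. c ^ w i * x i)"

definition orbit_count :: "nat \<Rightarrow> (nat \<Rightarrow> nat) \<Rightarrow> nat \<Rightarrow> (nat \<Rightarrow> 'a::field mpoly) \<Rightarrow> nat" where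
  "orbit_count n w m f =
     card (orbits mult_group (zero_locus n m f - {origin n}) (weighted_act n w))"

definition support_count :: "nat \<Rightarrow> nat \<Rightarrow> (nat \<Rightarrow> 'a::field mpoly) \<Rightarrow> nat set \<Rightarrow> nat" where
  "support_count n m f S = card {x \<in> zero_locus n m f. Supp n x = S}"

end

theory Submission
  imports Defs "HOL-Algebra.Multiplicative_Group" "HOL-Computational_Algebra.Polynomial"
begin

text \<open>
  The punctured cone is invariant under the weighted action by homogeneity. Orbit-stabilizer
  counting gives that the number of orbits times \<open>q - 1\<close> equals the sum of the stabilizer orders.
  The stabilizer of a point with support \<open>S\<close> consists of the \<open>c\<close> with \<open>c ^ w\<^sub>i = 1\<close> for all
  \<open>i \<in> S\<close>, i.e. of the roots of unity of order \<open>gcd k\<^sub>S (q - 1)\<close>, so its order depends only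
  on \<open>S\<close>; it remains to group the points by support.
\<close>

section \<open>Group actions on a set and orbit counting\<close>

text \<open>\<open>group_action\<close> asks for a homomorphism into \<open>BijGroup E\<close>,
  whose elements are extensional on \<open>E\<close>; hence the restriction of
  \<open>\<phi> g\<close>. Bijectivity comes from acting by the inverse element.\<close>

lemma group_actionI:
  assumes G: "group G"
    and closed: "\<And>g x. g \<in> carrier G \<Longrightarrow> x \<in> E \<Longrightarrow> \<phi> g x \<in> E"
    and one: "\<And>x. x \<in> E \<Longrightarrow> \<phi> \<one>\<^bsub>G\<^esub> x = x"
    and mult: "\<And>g h x. g \<in> carrier G \<Longrightarrow> h \<in> carrier G \<Longrightarrow> x \<in> E \<Longrightarrow>
      \<phi> (g \<otimes>\<^bsub>G\<^esub> h) x = \<phi> g (\<phi> h x)"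
  shows "group_action G E (\<lambda>g. \<lambda>x\<in>E. \<phi> g x)"
proof -
  interpret group G by fact
  have bij: "(\<lambda>x\<in>E. \<phi> g x) \<in> Bij E" if g: "g \<in> carrier G" for g
  proof -
    have "bij_betw (\<phi> g) E E"
      by (rule bij_betw_byWitness[where f' = "\<phi> (inv\<^bsub>G\<^esub> g)"])
        (use g in \<open>auto simp: closed one simp flip: mult\<close>)
    then show ?thesis
      by (auto simp: Bij_def bij_betw_def inj_on_def)
  qed
  have "(\<lambda>x\<in>E. \<phi> (g \<otimes>\<^bsub>G\<^esub> h) x) = compose E (\<lambda>x\<in>E. \<phi> g x) (\<lambda>x\<in>E. \<phi> h x)"
    if "g \<in> carrier G" "h \<in> carrier G" for g h
    using that by (auto simp: compose_def closed mult fun_eq_iff)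
  then show ?thesis
    unfolding group_action_def group_hom_def group_hom_axioms_def
    using G bij by (auto simp: group_BijGroup hom_def) (auto simp: BijGroup_def)
qed

text \<open>Orbits of points of \<open>E\<close> only evaluate the action on \<open>E\<close>. This
  leads back from the restricted action to the plain \<open>weighted_act\<close> in
  \<open>orbit_count\<close>.\<close>

lemma orbits_restrict:
  "orbits G E (\<lambda>g. \<lambda>x\<in>E. \<phi> g x) = orbits G E \<phi>"
proof -
  have "orbit G (\<lambda>g. \<lambda>x\<in>E. \<phi> g x) x = orbit G \<phi> x" if "x \<in> E" for x
    using that by (simp add: orbit_def)
  then show ?thesis
    unfolding orbits_def by metis
qed

text \<open>Along a single orbit the stabilizer orders add up to the group order, and the orbits
  partition \<open>E\<close>.\<close>

lemma (in group_action) card_orbits_mult_order: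
  assumes "finite (carrier G)" "finite E"
  shows "card (orbits G E \<phi>) * Coset.order G = (\<Sum>x\<in>E. card (stabilizer G \<phi> x))"
  using assms by (simp add: card_stablizer_sum flip: disjoint_sum)

section \<open>The multiplicative group of a finite field and its roots of unity\<close>

lemma group_mult_group: "group (mult_group :: 'a::field monoid)"
proof (rule groupI)
  show "\<exists>y\<in>carrier mult_group. y \<otimes>\<^bsub>mult_group\<^esub> x = \<one>\<^bsub>mult_group\<^esub>"
    if "x \<in> carrier mult_group" for x :: 'a
    using that by (intro bexI[of _ "inverse x"]) (auto simp: mult_group_def)
qed (auto simp: mult_group_def)

lemma mult_group_simps [simp]:
  "carrier mult_group = - {0}" "a \<otimes>\<^bsub>mult_group\<^esub> b = a * b" "\<one>\<^bsub>mult_group\<^esub> = 1"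
  by (simp_all add: mult_group_def)

lemma mult_group_nat_pow: "c [^]\<^bsub>mult_group\<^esub> (k::nat) = c ^ k"
  by (induction k)
    (simp_all add: monoid.nat_pow_0 monoid.nat_pow_Suc group.is_monoid group_mult_group)

lemma card_nonzero: "card (- {0::'a::{zero,finite}}) = CARD('a) - 1"
  by (metis Compl_eq_Diff_UNIV UNIV_I card_Diff_singleton)

lemma order_mult_group: "Coset.order (mult_group :: 'a::{field,finite} monoid) = CARD('a) - 1"
  by (simp add: Coset.order_def card_nonzero)

lemma power_card_minus_one:
  fixes c :: "'a::{field,finite}"
  assumes "c \<noteq> 0"
  shows "c ^ (CARD('a) - 1) = 1"
  using group.pow_order_eq_1[OF group_mult_group, of c] assms
  by (simp add: mult_group_nat_pow order_mult_group)

text \<open>With \<open>q - 1 = d * e\<close>, the polynomial \<open>X^(q-1) - 1\<close> vanishes at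
  all \<open>d * e\<close> nonzero elements and factors as \<open>X^d - 1\<close> times a polynomial
  of degree at most \<open>d * (e - 1)\<close>. The cofactor has too few roots to leave fewer than
  \<open>d\<close> for \<open>X^d - 1\<close>, whose degree forbids more.\<close>

lemma card_roots_of_unity_dvd:
  fixes d :: nat
  assumes d: "d dvd CARD('a::{field,finite}) - 1"
  shows "card {c::'a. c ^ d = 1} = d"
proof -
  obtain e where e: "CARD('a) - 1 = d * e"
    using d by auto
  have "2 \<le> CARD('a)"
    using card_mono[of UNIV "{0, 1::'a}"] by simp
  with e have d0: "d > 0" and e0: "e > 0"
    by (auto intro: Nat.gr0I)
  define p :: "'a poly" where "p = monom 1 d - 1"
  define r :: "'a poly" where "r = (\<Sum>i<e. monom 1 (d * i))"
  have "coeff p d = 1"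
    using d0 by (simp add: p_def)
  then have p0: "p \<noteq> 0"
    by auto
  have degp: "degree p \<le> d"
    unfolding p_def by (rule degree_diff_le) (auto simp: degree_monom_le)
  have polyp: "poly p c = c ^ d - 1" for c
    by (simp add: p_def poly_monom)
  \<comment> \<open>As \<open>d > 0\<close>, only the summand \<open>i = 0\<close> reaches the
    constant coefficient.\<close>
  have "coeff r 0 = 1"
    using d0 e0 by (simp add: r_def coeff_sum lessThan_def if_distrib)
  then have r0: "r \<noteq> 0"
    by auto
  have degr: "degree r \<le> d * (e - 1)"
    unfolding r_def by (rule degree_sum_le) (auto simp: degree_monom_eq)
  have polyr: "poly r c = (\<Sum>i<e. (c ^ d) ^ i)" for c
    by (simp add: r_def poly_sum poly_monom power_mult)
  have "poly p c = 0 \<or> poly r c = 0" if "c \<noteq> 0" for c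
  proof -
    \<comment> \<open>Geometric sum in \<open>c ^ d\<close>.\<close>
    have "poly p c * poly r c = (c ^ d) ^ e - 1"
      unfolding polyp polyr by (simp add: power_diff_1_eq)
    also have "\<dots> = 0"
      using power_card_minus_one[OF that] unfolding e by (simp flip: power_mult)
    finally show ?thesis
      by simp
  qed
  then have "- {0} \<subseteq> {c. poly p c = 0} \<union> {c. poly r c = 0}"
    by auto
  then have "card (- {0::'a}) \<le> card ({c. poly p c = 0} \<union> {c. poly r c = 0})"
    by (intro card_mono) auto
  also have "\<dots> \<le> card {c. poly p c = 0} + card {c. poly r c = 0}"
    by (rule card_Un_le)
  also have "card {c. poly r c = 0} \<le> d * (e - 1)"
    using card_poly_roots_bound[OF r0] degr by linarith
  finally have "d * e \<le> card {c. poly p c = 0} + d * (e - 1)"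
    using e by (simp add: card_nonzero)
  moreover have "d * e = d + d * (e - 1)"
    using e0 by (cases e) auto
  moreover have "card {c. poly p c = 0} \<le> d"
    using card_poly_roots_bound[OF p0] degp by linarith
  ultimately show ?thesis
    unfolding polyp by simp
qed

text \<open>Both sides say that the order of \<open>c\<close> divides certain numbers; it always
  divides \<open>q - 1\<close>, so this number may join the gcd.\<close>

lemma power_eq_one_iff_Gcd:
  fixes c :: "'a::{field,finite}"
  assumes c: "c \<noteq> 0"
  shows "(\<forall>i\<in>S. c ^ w i = 1) \<longleftrightarrow> c ^ gcd (Gcd (w ` S)) (CARD('a) - 1) = 1"
proof -
  interpret group "mult_group :: 'a monoid"
    by (rule group_mult_group)
  have *: "c ^ k = 1 \<longleftrightarrow> ord c dvd k" for k
    using pow_eq_id[of c k] c by (simp add: mult_group_nat_pow)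
  show ?thesis
    using power_card_minus_one[OF c] unfolding * by (simp add: dvd_Gcd_iff)
qed

lemma card_stabilizer_weights:
  "card {c::'a::{field,finite}. c \<noteq> 0 \<and> (\<forall>i\<in>S. c ^ w i = 1)}
    = gcd (Gcd (w ` S)) (CARD('a) - 1)"
proof -
  have "2 \<le> CARD('a)"
    using card_mono[of UNIV "{0, 1::'a}"] by simp
  \<comment> \<open>A positive exponent keeps \<open>c = 0\<close> out of the set of roots of unity,
    since then \<open>0 ^ k = 0\<close>.\<close>
  then have "gcd (Gcd (w ` S)) (CARD('a) - 1) > 0"
    by (simp add: gcd_pos_nat)
  then have "{c::'a. c \<noteq> 0 \<and> (\<forall>i\<in>S. c ^ w i = 1)} =
      {c. c ^ gcd (Gcd (w ` S)) (CARD('a) - 1) = 1}"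
    using power_eq_one_iff_Gcd[where 'a='a and S=S and w=w]
    by (metis (mono_tags, lifting) power_0_left zero_neq_one less_numeral_extra(3))
  then show ?thesis
    by (simp add: card_roots_of_unity_dvd)
qed

section \<open>The weighted action on the punctured cone\<close>

lemma mpoly_eval_weighted_act:
  assumes f: "f \<in> polys_in n"
    and hom: "\<And>a. a \<in> Poly_Mapping.keys f \<Longrightarrow> weighted_degree w a = d"
  shows "mpoly_eval f (weighted_act n w c x) = c ^ d * mpoly_eval f x"
proof -
  have "(\<Prod>i\<in>Poly_Mapping.keys a. weighted_act n w c x i ^ Poly_Mapping.lookup a i) =
      c ^ d * (\<Prod>i\<in>Poly_Mapping.keys a. x i ^ Poly_Mapping.lookup a i)"
    if a: "a \<in> Poly_Mapping.keys f" for a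
  proof -
    have "(\<Prod>i\<in>Poly_Mapping.keys a. weighted_act n w c x i ^ Poly_Mapping.lookup a i) =
        (\<Prod>i\<in>Poly_Mapping.keys a.
          c ^ (w i * Poly_Mapping.lookup a i) * x i ^ Poly_Mapping.lookup a i)"
      \<comment> \<open>\<open>polys_in n\<close> keeps the variables within \<open>{0..n}\<close>,
        outside of which \<open>weighted_act\<close> is \<open>undefined\<close>.\<close>
      using f a by (intro prod.cong)
        (auto simp: polys_in_def weighted_act_def power_mult_distrib power_mult subset_iff)
    then show ?thesis
      using hom[OF a] by (simp add: prod.distrib weighted_degree_def flip: power_sum)
  qed
  then show ?thesis
    by (simp add: mpoly_eval_def sum_distrib_left mult.left_commute)
qed

lemma weighted_act_in_zero_locus:
  assumes "\<forall>j \<in> {1..m}. f j \<in> polys_in n"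
    and "\<forall>j \<in> {1..m}. weighted_homogeneous w (f j)"
    and x: "x \<in> zero_locus n m f"
  shows "weighted_act n w c x \<in> zero_locus n m f"
proof -
  have "mpoly_eval (f j) (weighted_act n w c x) = 0" if j: "j \<in> {1..m}" for j
  proof -
    obtain d where "\<And>a. a \<in> Poly_Mapping.keys (f j) \<Longrightarrow> weighted_degree w a = d"
      using assms(2) j unfolding weighted_homogeneous_def by blast
    then show ?thesis
      using mpoly_eval_weighted_act[of "f j"] assms(1) x j by (simp add: zero_locus_def)
  qed
  then show ?thesis
    by (simp add: zero_locus_def affine_space_def weighted_act_def)
qed

lemma eq_origin_iff_Supp:
  assumes "x \<in> affine_space n"
  shows "x = origin n \<longleftrightarrow> Supp n x = {}"
proof
  assume "Supp n x = {}"
  then show "x = origin n"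
    using assms by (intro extensionalityI[of _ "{0..n}"])
      (auto simp: affine_space_def origin_def Supp_def PiE_def)
qed (auto simp: origin_def Supp_def)

text \<open>Nonzero coordinates can be cancelled, zero coordinates impose nothing, and outside
  \<open>{0..n}\<close> both points are \<open>undefined\<close>.\<close>

lemma weighted_act_eq_self_iff:
  assumes "x \<in> affine_space n"
  shows "weighted_act n w c x = x \<longleftrightarrow> (\<forall>i\<in>Supp n x. c ^ w i = 1)"
proof
  assume "weighted_act n w c x = x"
  then have "c ^ w i * x i = x i" if "i \<in> {0..n}" for i
    using that by (auto simp: weighted_act_def dest: fun_cong[of _ _ i])
  then show "\<forall>i\<in>Supp n x. c ^ w i = 1"
    by (auto simp: Supp_def)
next
  assume "\<forall>i\<in>Supp n x. c ^ w i = 1"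
  then show "weighted_act n w c x = x"
    using assms by (intro extensionalityI[of _ "{0..n}"])
      (auto simp: affine_space_def weighted_act_def Supp_def PiE_def)
qed

lemma group_action_weighted:
  fixes f :: "nat \<Rightarrow> 'a::field mpoly"
  assumes "\<forall>j \<in> {1..m}. f j \<in> polys_in n"
    and "\<forall>j \<in> {1..m}. weighted_homogeneous w (f j)"
  defines "E \<equiv> zero_locus n m f - {origin n}"
  shows "group_action mult_group E (\<lambda>c. \<lambda>x\<in>E. weighted_act n w c x)"
proof (rule group_actionI[OF group_mult_group])
  have aff: "x \<in> affine_space n" if "x \<in> zero_locus n m f" for x
    using that by (simp add: zero_locus_def)
  show "weighted_act n w c x \<in> E" if "c \<in> carrier mult_group" "x \<in> E" for c x
  proof -
    have "weighted_act n w c x \<in> zero_locus n m f"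
      using weighted_act_in_zero_locus[OF assms(1,2)] that by (simp add: E_def)
    \<comment> \<open>Powers of a nonzero \<open>c\<close> are nonzero, so no point is moved to the
      origin, the only point with empty support.\<close>
    moreover have "Supp n (weighted_act n w c x) = Supp n x"
      using that by (auto simp: Supp_def weighted_act_def)
    ultimately show ?thesis
      using that eq_origin_iff_Supp[OF aff] by (auto simp: E_def)
  qed
  show "weighted_act n w \<one>\<^bsub>mult_group\<^esub> x = x" if "x \<in> E" for x
    using that by (simp add: E_def aff weighted_act_eq_self_iff)
  show "weighted_act n w (b \<otimes>\<^bsub>mult_group\<^esub> c) x = weighted_act n w b (weighted_act n w c x)"
    for b c x
    by (auto simp: weighted_act_def power_mult_distrib mult.assoc)
qed

theorem proposition8p1:
  fixes n m q :: nat
    and w :: "nat \<Rightarrow> nat"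
    and f :: "nat \<Rightarrow> 'a::{field,finite} mpoly"
  assumes q: "q = CARD('a)"
    and w_pos: "\<forall>i \<in> {0..n}. w i > 0"
    and f_vars: "\<forall>j \<in> {1..m}. f j \<in> polys_in n"
    and f_hom: "\<forall>j \<in> {1..m}. weighted_homogeneous w (f j)"
  shows "real (orbit_count n w m f) =
    (\<Sum>S \<in> Pow {0..n} - {{}}.
       real (support_count n m f S) / (real q - 1) * real (gcd (Gcd (w ` S)) (q - 1)))"
proof -
  define E where "E = zero_locus n m f - {origin n}"
  define \<phi> where "\<phi> = (\<lambda>c::'a. \<lambda>x\<in>E. weighted_act n w c x)"
  define k where "k S = gcd (Gcd (w ` S)) (q - 1)" for S
  interpret group_action mult_group E \<phi>
    unfolding E_def \<phi>_def by (rule group_action_weighted[OF f_vars f_hom])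
  have "2 \<le> q"
    using card_mono[of UNIV "{0, 1::'a}"] q by simp
  have fin: "finite E"
    unfolding E_def zero_locus_def affine_space_def
    by (rule finite_subset[of _ "{0..n} \<rightarrow>\<^sub>E UNIV"]) (auto intro: finite_PiE)
  have E_iff: "x \<in> E \<longleftrightarrow> x \<in> zero_locus n m f \<and> Supp n x \<noteq> {}" for x
    using eq_origin_iff_Supp[of x n] by (auto simp: E_def zero_locus_def)
  have stab: "card (stabilizer mult_group \<phi> x) = k (Supp n x)" if "x \<in> E" for x
  proof -
    have "stabilizer mult_group \<phi> x = {c. c \<noteq> 0 \<and> (\<forall>i\<in>Supp n x. c ^ w i = 1)}"
      using that by (auto simp: stabilizer_def \<phi>_def E_def zero_locus_def weighted_act_eq_self_iff)
    then show ?thesis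
      by (simp add: card_stabilizer_weights k_def q)
  qed
  \<comment> \<open>The count is done in the naturals, multiplied through by \<open>q - 1\<close>;
    the division comes only at the end.\<close>
  have "orbit_count n w m f * (q - 1) = card (orbits mult_group E \<phi>) * Coset.order (mult_group :: 'a monoid)"
    by (simp add: orbit_count_def E_def \<phi>_def orbits_restrict order_mult_group q)
  also have "\<dots> = (\<Sum>x\<in>E. k (Supp n x))"
    using card_orbits_mult_order fin stab by simp
  also have "\<dots> = (\<Sum>S\<in>Pow {0..n} - {{}}. \<Sum>x\<in>{x\<in>E. Supp n x = S}. k (Supp n x))"
    using fin E_iff by (intro sum.group[symmetric]) (auto simp: Supp_def)
  also have "\<dots> = (\<Sum>S\<in>Pow {0..n} - {{}}. support_count n m f S * k S)"
  proof (rule sum.cong[OF refl])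
    fix S assume "S \<in> Pow {0..n} - {{}}"
    \<comment> \<open>A nonempty support already excludes the origin.\<close>
    then have "{x\<in>E. Supp n x = S} = {x \<in> zero_locus n m f. Supp n x = S}"
      using E_iff by auto
    then show "(\<Sum>x\<in>{x\<in>E. Supp n x = S}. k (Supp n x)) = support_count n m f S * k S"
      by (simp add: support_count_def)
  qed
  finally have "real (orbit_count n w m f * (q - 1)) =
      real (\<Sum>S\<in>Pow {0..n} - {{}}. support_count n m f S * k S)"
    by simp
  \<comment> \<open>\<open>2 \<le> q\<close> turns the truncated \<open>q - 1\<close> into
    \<open>real q - 1\<close> and makes it nonzero.\<close>
  with \<open>2 \<le> q\<close> have "real (orbit_count n w m f) =
      (\<Sum>S\<in>Pow {0..n} - {{}}. real (support_count n m f S) * real (k S)) / (real q - 1)"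
    by (simp add: of_nat_diff eq_divide_eq)
  then show ?thesis
    by (simp add: k_def sum_divide_distrib)
qed

end
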